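(* (1) Any quadratic Lie algebra of type $\mathsf S_1$ is solvable and is a double extension. (2) A quadratic Lie algebra is singular and solvable if and only if it is a double extension of a quadratic vector space by a non-zero skew-symmetric map.
   Context: All vector spaces are finite-dimensional over $\mathbb C$. A quadratic vector space is a vector space with a non-degenerate symmetric bilinear form. A quadratic Lie algebra $(\mathfrak g,B)$ is a Lie algebra with a non-degenerate symmetric invariant bilinear form $B$, i.e. $B([X,Y],Z)=B(X,[Y,Z])$. Its associated 3-form is $I(X,Y,Z)=B([X,Y],Z)$ and its $\mathrm{dup}$-number is $\mathrm{dup}(\mathfrak g)=\dim\{\alpha\in\mathfrak g^*\mid\alpha\wedge I=0\}$. A non-Abelian quadratic Lie algebra is singular if $\mathrm{dup}(\mathfrak g)\ge1$; it is of type $\mathsf S_1$ if $\mathrm{dup}(\mathfrak g)=1$. Double extension: let $(\mathfrak q,B_{\mathfrak q})$ be a quadratic vector space and $\overline C:\mathfrak q\to\mathfrak q$ a map skew-symmetric with respect to $B_{\mathfrak q}$. Let $\mathfrak t=\mathrm{span}\{X_1,Y_1\}$ be a 2-dimensional quadratic vector space with $B_{\mathfrak t}(X_1,X_1)=B_{\mathfrak t}(Y_1,Y_1)=0$, $B_{\mathfrak t}(X_1,Y_1)=1$. The double extension of $\mathfrak q$ by $\overline C$ is $\mathfrak g=\mathfrak q\oplus\mathfrak t$ (orthogonal direct sum, with form $B=B_{\mathfrak q}+B_{\mathfrak t}$) with bracket $[X+\lambda X_1+\mu Y_1,\,Y+\lambda' X_1+\mu' Y_1]=\mu\overline C(Y)-\mu'\overline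 C(X)+B(\overline C(X),Y)X_1$ for $X,Y\in\mathfrak q$, $\lambda,\mu,\lambda',\mu'\in\mathbb C$. It is a quadratic Lie algebra. A quadratic Lie algebra $\mathfrak g$ "is a double extension" if it has an orthogonal decomposition $\mathfrak g=(\mathbb CX_1\oplus\mathbb CY_1)\oplus\mathfrak q$ of this form with bracket of this form for some skew-symmetric $\overline C$ (equivalently, it is isometrically isomorphic to such an algebra). *)

theory Defs
  imports Complex_Main "HOL-Library.Function_Algebras"
begin

(* Finite-dimensional complex vector spaces are types with a scalar multiplication; the finite
   set Basis only witnesses finite-dimensionality and no later notion depends on it. *)

locale lie_algebra = finite_dimensional_vector_space scale Basis
  for scale :: "complex \<Rightarrow> 'a::ab_group_add \<Rightarrow> 'a" and Basis :: "'a set" +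
  fixes bracket :: "'a \<Rightarrow> 'a \<Rightarrow> 'a"
  assumes bracket_linear_right: "Vector_Spaces.linear scale scale (bracket x)"
    and bracket_linear_left: "Vector_Spaces.linear scale scale (\<lambda>x. bracket x y)"
    and bracket_self: "bracket x x = 0"
    and jacobi: "bracket x (bracket y z) + bracket y (bracket z x) + bracket z (bracket x y) = 0"
begin

definition abelian :: bool where
  "abelian \<longleftrightarrow> (\<forall>x y. bracket x y = 0)"

primrec derived_series :: "nat \<Rightarrow> 'a set" where
  "derived_series 0 = UNIV"
| "derived_series (Suc n) =
     span {bracket x y | x y. x \<in> derived_series n \<and> y \<in> derived_series n}"

definition solvable :: bool where
  "solvable \<longleftrightarrow> (\<exists>n. derived_series n = {0})"

end

locale quadratic_space = finite_dimensional_vector_space scale Basis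
  for scale :: "complex \<Rightarrow> 'a::ab_group_add \<Rightarrow> 'a" and Basis :: "'a set" +
  fixes B :: "'a \<Rightarrow> 'a \<Rightarrow> complex"
  assumes form_linear: "Vector_Spaces.linear scale (*) (B x)"
    and form_sym: "B x y = B y x"
    and form_nondegenerate: "(\<And>y. B x y = 0) \<Longrightarrow> x = 0"
begin

definition quadratic_subspace :: "'a set \<Rightarrow> bool" where
  "quadratic_subspace q \<longleftrightarrow> subspace q \<and> (\<forall>x\<in>q. (\<forall>y\<in>q. B x y = 0) \<longrightarrow> x = 0)"

(* C is a linear endomorphism of q; its values outside q are irrelevant. *)
definition skew_symmetric_on :: "'a set \<Rightarrow> ('a \<Rightarrow> 'a) \<Rightarrow> bool" where
  "skew_symmetric_on q C \<longleftrightarrow>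
     (\<forall>x\<in>q. C x \<in> q) \<and>
     (\<forall>x\<in>q. \<forall>y\<in>q. C (x + y) = C x + C y) \<and>
     (\<forall>c. \<forall>x\<in>q. C (scale c x) = scale c (C x)) \<and>
     (\<forall>x\<in>q. \<forall>y\<in>q. B (C x) y = - B x (C y))"

end

(* The dual space is a subspace of 'a => complex, with the pointwise operations. *)
definition form_scale :: "complex \<Rightarrow> ('a \<Rightarrow> complex) \<Rightarrow> 'a \<Rightarrow> complex" where
  "form_scale c f = (\<lambda>x. c * f x)"

interpretation form: vector_space form_scale
  by standard (auto simp: form_scale_def fun_eq_iff algebra_simps)

(* Wedge product of a 1-form with an alternating 3-form, normalised as the sum over shuffles. *)
definition wedge13 ::
  "('a \<Rightarrow> complex) \<Rightarrow> ('a \<Rightarrow> 'a \<Rightarrow> 'a \<Rightarrow> complex) \<Rightarrow> 'a \<Rightarrow> 'a \<Rightarrow> 'a \<Rightarrow> 'a \<Rightarrow> complex" where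
  "wedge13 \<alpha> J x y z w =
     \<alpha> x * J y z w - \<alpha> y * J x z w + \<alpha> z * J x y w - \<alpha> w * J x y z"

locale quadratic_lie_algebra =
  lie_algebra scale Basis bracket + quadratic_space scale Basis B
  for scale :: "complex \<Rightarrow> 'a::ab_group_add \<Rightarrow> 'a" and Basis bracket B +
  assumes form_invariant: "B (bracket x y) z = B x (bracket y z)"
begin

definition three_form :: "'a \<Rightarrow> 'a \<Rightarrow> 'a \<Rightarrow> complex" where
  "three_form x y z = B (bracket x y) z"

definition dup :: nat where
  "dup = form.dim {\<alpha>. Vector_Spaces.linear scale (*) \<alpha> \<and>
                      (\<forall>x y z w. wedge13 \<alpha> three_form x y z w = 0)}"

definition singular :: bool where
  "singular \<longleftrightarrow> \<not> abelian \<and> dup \<ge> 1"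

definition type_S1 :: bool where
  "type_S1 \<longleftrightarrow> \<not> abelian \<and> dup = 1"

(* The algebra is the orthogonal direct sum of the quadratic vector space q and a hyperbolic
   plane spanned by X1 and Y1, with the double extension bracket given by C. *)
definition double_extension_by :: "'a set \<Rightarrow> ('a \<Rightarrow> 'a) \<Rightarrow> bool" where
  "double_extension_by q C \<longleftrightarrow>
     quadratic_subspace q \<and> skew_symmetric_on q C \<and>
     (\<exists>X1 Y1.
        B X1 X1 = 0 \<and> B Y1 Y1 = 0 \<and> B X1 Y1 = 1 \<and>
        (\<forall>x\<in>q. B x X1 = 0 \<and> B x Y1 = 0) \<and>
        q \<inter> span {X1, Y1} = {0} \<and>
        {x + t | x t. x \<in> q \<and> t \<in> span {X1, Y1}} = UNIV \<and>
        (\<forall>x\<in>q. \<forall>y\<in>q. \<forall>a b a' b'.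
           bracket (x + scale a X1 + scale b Y1) (y + scale a' X1 + scale b' Y1)
             = scale b (C y) - scale b' (C x) + scale (B (C x) y) X1))"

definition double_extension :: bool where
  "double_extension \<longleftrightarrow> (\<exists>q C. double_extension_by q C)"

end

end

theory Submission imports Defs begin

text \<open>By non-degeneracy every linear form is \<open>B v\<close> for a unique vector \<open>v\<close>, so \<open>dup\<close> is the dimension
  of the space of vectors \<open>v\<close> with \<open>B v \<and> I = 0\<close>, here called dup vectors. The equation
  \<open>B v \<and> I = 0\<close> says precisely that
  \<open>B v x \<cdot> [y,z] - B v y \<cdot> [x,z] + B v z \<cdot> [x,y] = I x y z \<cdot> v\<close>; in particular the bracket of any two
  vectors orthogonal to \<open>v\<close> is a multiple of \<open>v\<close>.

  Everything reduces to finding a \<^emph>\<open>central\<close> dup vector \<open>v \<noteq> 0\<close>. In a non-Abelian algebra such a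
  vector is isotropic. Complete it to a hyperbolic plane spanned by \<open>v\<close> and \<open>Y\<close>. On the orthogonal
  complement \<open>q\<close> of this plane the displayed equation reads \<open>[x,z] = B [Y,x] z \<cdot> v\<close>, which is the
  bracket of the double extension of \<open>q\<close> by \<open>ad Y\<close>. The algebra is solvable because \<open>[g,g]\<close> is
  orthogonal to \<open>v\<close>, whence \<open>[[g,g],[g,g]]\<close> lies on the line through \<open>v\<close>. Conversely, in any double
  extension the isotropic vector \<open>X1\<close> of the plane is a central dup vector.

  A central dup vector is found as follows. The dup vectors form an ideal because \<open>I\<close> is invariant.
  A line that is an ideal is central, because \<open>[t,v] = c t \<cdot> v\<close> gives
  \<open>0 = B [t,v] t = c t \<cdot> B v t\<close> for all \<open>t\<close>. This settles \<open>dup = 1\<close>. If some dup vector is not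
  central, then there are two independent ones, which forces \<open>I\<close> to be a product of three linear
  forms, and then all brackets are dup vectors. If the algebra is also solvable and not Abelian,
  \<open>[g,g]\<close> contains a non-zero central vector: \<open>[g,g]\<^sup>\<bottom>\<close> is the centre, so otherwise
  \<open>g\<close> would be the sum of \<open>[g,g]\<close> and the centre, and the non-zero algebra \<open>[g,g]\<close> would be perfect.\<close>

section \<open>Linear algebra of a non-degenerate form\<close>

context quadratic_space
begin

lemma form_add_right: "B x (y + z) = B x y + B x z"
  and form_scale_right: "B x (scale c y) = c * B x y"
  using form_linear[of x] by (simp_all add: Vector_Spaces.linear_iff)

lemma form_add_left: "B (x + y) z = B x z + B y z"
  and form_scale_left: "B (scale c x) y = c * B x y"
  using form_add_right[of z x y] form_scale_right[of y c x]
    form_sym[of "x + y" z] form_sym[of x z] form_sym[of y z] form_sym[of "scale c x" y] form_sym[of x y]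
  by argo+

lemma form_zero_right: "B x 0 = 0"
  and form_zero_left: "B 0 x = 0"
  using form_scale_right[of x 0 0] form_scale_left[of 0 0 x] by simp_all

lemma form_minus_right: "B x (- y) = - B x y"
  and form_minus_left: "B (- x) y = - B x y"
  using form_add_right[of x y "- y"] form_add_left[of x "- x" y]
  by (simp_all add: form_zero_left form_zero_right add_eq_0_iff)

lemma form_diff_right: "B x (y - z) = B x y - B x z"
  and form_diff_left: "B (x - y) z = B x z - B y z"
  using form_add_right[of x "y - z" z] form_add_left[of "x - y" y z] by simp_all

lemmas form_simps = form_add_right form_add_left form_scale_right form_scale_left
  form_zero_right form_zero_left form_minus_right form_minus_left form_diff_right form_diff_left

lemma form_eqI: "(\<And>z. B x z = B y z) \<Longrightarrow> x = y"
  using form_nondegenerate[of "x - y"] by (simp add: form_simps)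

lemma form_dual_vector:
  assumes "x \<noteq> 0"
  obtains y where "B x y = 1"
proof -
  obtain y where "B x y \<noteq> 0"
    using form_nondegenerate assms by blast
  then have "B x (scale (1 / B x y) y) = 1"
    by (simp add: form_simps)
  then show ?thesis
    by (rule that)
qed

text \<open>The Gram map \<open>x \<mapsto> \<Sum>b. B x b b\<close> over a basis of \<open>S\<close> is injective on \<open>S\<close> precisely because
  \<open>S\<close> meets its orthogonal complement trivially, hence it maps \<open>S\<close> onto \<open>S\<close>; a preimage of the
  vector with coordinates \<open>f b\<close> represents \<open>f\<close>.\<close>

lemma functional_represented_in_nondegenerate_subspace:
  assumes "quadratic_subspace S" and f: "Vector_Spaces.linear scale (*) f"
  obtains s where "s \<in> S" "\<And>t. t \<in> S \<Longrightarrow> B s t = f t"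
proof -
  interpret pair: finite_dimensional_vector_space_pair scale Basis scale Basis
    by unfold_locales
  interpret functional: vector_space_pair scale "(*) :: complex \<Rightarrow> complex \<Rightarrow> complex"
    by unfold_locales (simp_all add: algebra_simps)
  have S: "subspace S" and nondeg: "\<And>x. x \<in> S \<Longrightarrow> (\<And>y. y \<in> S \<Longrightarrow> B x y = 0) \<Longrightarrow> x = 0"
    using assms(1) by (auto simp: quadratic_subspace_def)
  obtain T where T: "T \<subseteq> S" "independent T" "S \<subseteq> span T" "card T = dim S"
    by (rule basis_exists)
  have span_T: "span T = S"
    using T S by (simp add: span_minimal subset_antisym)
  have fin: "finite T"
    using T(2) by (rule finiteI_independent)
  define \<phi> where "\<phi> x = (\<Sum>b\<in>T. scale (B x b) b)" for x
  have lin: "Vector_Spaces.linear scale scale \<phi>"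
    by (auto simp: Vector_Spaces.linear_iff \<phi>_def form_simps scale_left_distrib sum.distrib
        scale_sum_right vector_space_axioms)
  have agree: "B x t = g t"
    if "Vector_Spaces.linear scale (*) g" "\<And>b. b \<in> T \<Longrightarrow> B x b = g b" "t \<in> S" for x t g
    by (rule functional.linear_eq_on[OF form_linear that(1) _ that(2), of t T])
      (simp_all add: span_T that(3))
  have image_sub: "\<phi> ` S \<subseteq> S"
    unfolding \<phi>_def using S T(1) by (auto intro!: subspace_sum subspace_scale)
  have coeff: "B x b = c b" if "\<phi> x = (\<Sum>b\<in>T. scale (c b) b)" "b \<in> T" for x b c
    using that independentD[OF T(2) fin subset_refl, of "\<lambda>b. B x b - c b" b]
    by (simp add: \<phi>_def scale_left_diff_distrib sum_subtractf)
  have "inj_on \<phi> S"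
  proof (rule inj_onI)
    fix x y assume xy: "x \<in> S" "y \<in> S" "\<phi> x = \<phi> y"
    then have "B x b = B y b" if "b \<in> T" for b
      using coeff[of x "B y", OF _ that] xy(3) unfolding \<phi>_def by blast
    then have "B x t = B y t" if "t \<in> S" for t
      using agree[OF form_linear[of y], of x t] that by simp
    then have "x - y = 0"
      using xy S by (intro nondeg) (simp_all add: form_simps subspace_diff)
    then show "x = y" by simp
  qed
  then have "dim (\<phi> ` S) = dim S"
    using S by (intro pair.dim_image_eq lin) (simp add: span_eq_iff[THEN iffD2])
  moreover have "subspace (\<phi> ` S)"
    using lin S by (rule pair.linear_subspace_image)
  ultimately have "\<phi> ` S = S"
    using S image_sub by (intro subspace_dim_equal) auto
  moreover have "(\<Sum>b\<in>T. scale (f b) b) \<in> S"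
    using S T(1) by (auto intro!: subspace_sum subspace_scale)
  ultimately obtain s where s: "s \<in> S" "\<phi> s = (\<Sum>b\<in>T. scale (f b) b)"
    by (metis imageE)
  from s(1) show ?thesis
    by (rule that) (rule agree[OF f coeff[OF s(2)]])
qed

lemma functional_represented:
  assumes "Vector_Spaces.linear scale (*) f"
  obtains v where "f = B v"
proof -
  have "quadratic_subspace UNIV"
    using form_nondegenerate by (simp add: quadratic_subspace_def)
  from functional_represented_in_nondegenerate_subspace[OF this assms]
  obtain v where "\<And>t. t \<in> UNIV \<Longrightarrow> B v t = f t"
    by metis
  then have "f = B v"
    by (simp add: fun_eq_iff)
  then show ?thesis
    by (rule that)
qed

text \<open>The projection of \<open>x\<close> represents the functional \<open>B x\<close> on \<open>S\<close>.\<close>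

lemma orthogonal_decomposition:
  assumes "quadratic_subspace S"
  shows "\<exists>s\<in>S. \<forall>t\<in>S. B (x - s) t = 0"
proof -
  from functional_represented_in_nondegenerate_subspace[OF assms form_linear[of x]]
  obtain s where "s \<in> S" "\<And>t. t \<in> S \<Longrightarrow> B s t = B x t"
    by metis
  then show ?thesis
    by (intro bexI[of _ s]) (simp_all add: form_simps)
qed

text \<open>This bounds the size of independent sets of functionals, without which a dimension computed in
  the space of all functions could be the default value \<open>0\<close>.\<close>

lemma functionals_finitely_spanned:
  "{f. Vector_Spaces.linear scale (*) f} \<subseteq> form.span (B ` Basis)"
proof
  fix f :: "'a \<Rightarrow> complex" assume "f \<in> {f. Vector_Spaces.linear scale (*) f}"
  then obtain v where v: "f = B v"
    by (auto elim: functional_represented)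
  interpret vector_space_pair scale "form_scale :: _ \<Rightarrow> ('a \<Rightarrow> complex) \<Rightarrow> _"
    by unfold_locales
  have "Vector_Spaces.linear scale form_scale B"
    by (auto simp: Vector_Spaces.linear_iff form_simps form_scale_def fun_eq_iff
        vector_space_axioms form.vector_space_axioms)
  from linear_span_image[OF this, of Basis] show "f \<in> form.span (B ` Basis)"
    using v by (auto simp: span_Basis)
qed

end

section \<open>Vectors whose dual form divides the 3-form\<close>

context quadratic_lie_algebra
begin

lemma bracket_add_right: "bracket x (y + z) = bracket x y + bracket x z"
  and bracket_scale_right: "bracket x (scale c y) = scale c (bracket x y)"
  using bracket_linear_right[of x] by (simp_all add: Vector_Spaces.linear_iff)

lemma bracket_add_left: "bracket (x + y) z = bracket x z + bracket y z"
  and bracket_scale_left: "bracket (scale c x) y = scale c (bracket x y)"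
  using bracket_linear_left[of z] bracket_linear_left[of y] by (simp_all add: Vector_Spaces.linear_iff)

lemma bracket_zero_right: "bracket x 0 = 0"
  and bracket_zero_left: "bracket 0 x = 0"
  using bracket_scale_right[of x 0 0] bracket_scale_left[of 0 0 x] by simp_all

lemma bracket_anticommute: "bracket x y = - bracket y x"
  using bracket_self[of "x + y"] unfolding bracket_add_right bracket_add_left
  by (simp add: bracket_self eq_neg_iff_add_eq_0 add.commute)

lemma bracket_minus_right: "bracket x (- y) = - bracket x y"
  and bracket_minus_left: "bracket (- x) y = - bracket x y"
  using bracket_add_right[of x y "- y"] bracket_add_left[of x "- x" y]
  by (simp_all add: bracket_zero_left bracket_zero_right add_eq_0_iff)

lemma bracket_diff_right: "bracket x (y - z) = bracket x y - bracket x z"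
  and bracket_diff_left: "bracket (x - y) z = bracket x z - bracket y z"
  using bracket_add_right[of x "y - z" z] bracket_add_left[of "x - y" y z] by simp_all

lemmas bracket_simps = bracket_add_right bracket_add_left bracket_scale_right bracket_scale_left
  bracket_zero_right bracket_zero_left bracket_minus_right bracket_minus_left bracket_diff_right bracket_diff_left

lemma three_form_swap: "three_form y x z = - three_form x y z"
  unfolding three_form_def using bracket_anticommute[of y x] by (simp add: form_simps)

text \<open>\<open>I\<close> is invariant under \<open>ad t\<close>: by the Jacobi identity the first two terms combine to
  \<open>B [t,[x,y]] z\<close>, which cancels the third by invariance of \<open>B\<close>.\<close>

lemma three_form_derivation:
  "three_form (bracket t x) y z + three_form x (bracket t y) z + three_form x y (bracket t z) = 0"
proof -
  have "bracket (bracket t x) y + bracket x (bracket t y) = bracket t (bracket x y)"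
    using jacobi[of t x y] bracket_anticommute[of y t] bracket_anticommute[of y "bracket t x"]
    by (simp add: bracket_simps algebra_simps)
  then have "three_form (bracket t x) y z + three_form x (bracket t y) z = B (bracket t (bracket x y)) z"
    unfolding three_form_def by (metis form_add_left)
  also have "\<dots> = - B (bracket x y) (bracket t z)"
    by (metis bracket_anticommute form_invariant form_minus_left)
  finally show ?thesis
    by (simp add: three_form_def)
qed

definition central :: "'a \<Rightarrow> bool" where
  "central v \<longleftrightarrow> (\<forall>x. bracket v x = 0)"

definition dup_vector :: "'a \<Rightarrow> bool" where
  "dup_vector v \<longleftrightarrow> (\<forall>x y z w. wedge13 (B v) three_form x y z w = 0)"

lemma dup_vector_wedge:
  assumes "dup_vector v"
  shows "B v x * three_form y z w - B v y * three_form x z w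
       + B v z * three_form x y w - B v w * three_form x y z = 0"
  using assms by (simp add: dup_vector_def wedge13_def)

lemma subspace_dup_vector: "subspace {v. dup_vector v}"
proof -
  have "wedge13 (B (u + v)) J x y z w = wedge13 (B u) J x y z w + wedge13 (B v) J x y z w"
    and "wedge13 (B (scale c u)) J x y z w = c * wedge13 (B u) J x y z w" for u v J x y z w c
    by (simp_all add: wedge13_def form_simps algebra_simps)
  then show ?thesis
    by (auto simp: subspace_def dup_vector_def) (simp add: wedge13_def form_simps)
qed

text \<open>The equation \<open>B v \<and> I = 0\<close> with its last argument stripped off by non-degeneracy.\<close>

lemma dup_vector_bracket:
  assumes "dup_vector v"
  shows "scale (B v x) (bracket y z) - scale (B v y) (bracket x z) + scale (B v z) (bracket x y)
       = scale (three_form x y z) v"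
  using dup_vector_wedge[OF assms, of x y z]
  by (intro form_eqI) (simp add: form_simps three_form_def algebra_simps)

lemma dup_vector_bracket_orthogonal:
  assumes "dup_vector v" "B v y = 1" "B v x = 0" "B v z = 0"
  shows "bracket x z = scale (B (bracket y x) z) v"
  using dup_vector_bracket[OF assms(1), of y x z] assms(2-4) by (simp add: three_form_def)

text \<open>The operator \<open>ad t\<close> acts as a derivation on forms and annihilates \<open>I\<close>, so applying it to
  \<open>B v \<and> I = 0\<close> leaves, up to sign, \<open>B [t,v] \<and> I = 0\<close>.\<close>

lemma dup_vector_ideal:
  assumes "dup_vector v"
  shows "dup_vector (bracket t v)"
proof -
  have flip: "B (bracket t v) x = - B v (bracket t x)" for x
    by (metis bracket_anticommute form_invariant form_minus_left)
  have "wedge13 (B (bracket t v)) three_form x y z w = 0" for x y z w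
  proof -
    \<comment> \<open>\<open>?W\<close> is \<open>B v \<and> I\<close>, and \<open>?D\<close> is the action of \<open>ad t\<close> on \<open>I\<close>; both vanish identically.\<close>
    let ?W = "\<lambda>x y z w. B v x * three_form y z w - B v y * three_form x z w
       + B v z * three_form x y w - B v w * three_form x y z"
    let ?D = "\<lambda>x y z. three_form (bracket t x) y z + three_form x (bracket t y) z
       + three_form x y (bracket t z)"
    have "wedge13 (B (bracket t v)) three_form x y z w =
        - (?W (bracket t x) y z w + ?W x (bracket t y) z w
           + ?W x y (bracket t z) w + ?W x y z (bracket t w))
        + (B v x * ?D y z w - B v y * ?D x z w + B v z * ?D x y w - B v w * ?D x y z)"
      unfolding wedge13_def flip by (simp add: algebra_simps)
    also have "\<dots> = 0"
      by (simp only: dup_vector_wedge[OF assms] three_form_derivation) simp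
    finally show ?thesis .
  qed
  then show ?thesis
    by (simp add: dup_vector_def)
qed

text \<open>If \<open>v\<close> is central, the bracket identity at \<open>x = v\<close> collapses to \<open>B v v \<cdot> [y,z] = 0\<close>.\<close>

lemma central_dup_vector_isotropic:
  assumes "\<not> abelian" "dup_vector v" "central v"
  shows "B v v = 0"
proof (rule ccontr)
  assume "B v v \<noteq> 0"
  moreover have "scale (B v v) (bracket y z) = 0" for y z
    using dup_vector_bracket[OF assms(2), of v y z] assms(3)
    by (simp add: central_def three_form_def form_simps)
  ultimately show False
    using assms(1) by (simp add: abelian_def)
qed

text \<open>If \<open>[t,v] = c \<cdot> v\<close>, then \<open>c \<cdot> B v t = B [t,v] t = 0\<close>, so \<open>[t,v] = 0\<close> for all \<open>t\<close> outside the
  hyperplane orthogonal to \<open>v\<close>. Such \<open>t\<close> span the whole space.\<close>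

lemma central_if_spans_ideal:
  assumes "v \<noteq> 0" "\<And>t. \<exists>c. bracket t v = scale c v"
  shows "central v"
proof -
  have zero: "bracket t v = 0" if "B v t \<noteq> 0" for t
  proof -
    obtain c where c: "bracket t v = scale c v" using assms(2) by blast
    have "B (bracket t v) t = 0"
      by (metis bracket_anticommute bracket_self form_invariant form_minus_left form_zero_right neg_0_equal_iff_equal)
    then show ?thesis using that c by (simp add: form_simps)
  qed
  obtain y where y: "B v y = 1" using assms(1) by (rule form_dual_vector)
  have "bracket t v = 0" for t
  proof (cases "B v t = 0")
    case True
    then have "bracket (t + y) v = 0" using y by (intro zero) (simp add: form_simps)
    then show ?thesis using zero[of y] y by (simp add: bracket_simps)
  qed (rule zero)
  then show ?thesis
    unfolding central_def by (metis bracket_anticommute neg_0_equal_iff_equal)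
qed

text \<open>Two independent forms \<open>B u\<close> and \<open>B v\<close> dividing \<open>I\<close> make it decomposable:
  \<open>I = B u \<and> B v \<and> \<theta>\<close>, where \<open>\<theta>\<close> is the contraction of \<open>I\<close> with vectors \<open>x1\<close>, \<open>x2\<close> that are suitably
  normalised against \<open>u\<close> and \<open>v\<close>. Hence \<open>\<theta>\<close>, which is dual to \<open>c = [x1,x2]\<close>, also divides \<open>I\<close>, and
  every bracket is a combination of \<open>u\<close>, \<open>v\<close> and \<open>c\<close>.\<close>

lemma brackets_are_dup_vectors:
  assumes u: "dup_vector u" and v: "dup_vector v" "v \<noteq> 0" and indep: "\<And>c. u \<noteq> scale c v"
  shows "dup_vector (bracket a b)"
proof -
  obtain x2 where x2: "B v x2 = 1"
    using v(2) by (rule form_dual_vector)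
  \<comment> \<open>Subtracting the right multiple of \<open>v\<close> makes the dual form vanish on \<open>x2\<close>, so \<open>z\<close> can be moved
    into the kernel of \<open>B v\<close> along \<open>x2\<close> without changing the value of that form.\<close>
  obtain z where z: "B (u - scale (B u x2) v) z = 1"
    using indep[of "B u x2"] form_dual_vector[of "u - scale (B u x2) v"] by auto
  define x1 where "x1 = z - scale (B v z) x2"
  have x1: "B u x1 = 1" "B v x1 = 0"
    using x2 z by (simp_all add: x1_def form_simps algebra_simps)
  define \<theta> where "\<theta> = three_form x1 x2"
  have contracted: "three_form x1 y w = B v y * \<theta> w - B v w * \<theta> y" for y w
    using dup_vector_wedge[OF v(1), of x2 x1 y w] x1 x2
    by (simp add: \<theta>_def three_form_swap[of x1 x2] algebra_simps)
  have decomposed: "three_form x y w = B u x * (B v y * \<theta> w - B v w * \<theta> y)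
      - B u y * (B v x * \<theta> w - B v w * \<theta> x) + B u w * (B v x * \<theta> y - B v y * \<theta> x)" for x y w
    using dup_vector_wedge[OF u, of x1 x y w, unfolded contracted x1] by (simp add: algebra_simps)
  define c where "c = bracket x1 x2"
  have Bc: "B c x = \<theta> x" for x
    by (simp add: c_def \<theta>_def three_form_def)
  have "dup_vector c"
    unfolding dup_vector_def wedge13_def Bc decomposed by (simp add: algebra_simps)
  then have "scale r u + scale s v + scale t c \<in> {v. dup_vector v}" for r s t
    using u v(1) by (intro subspace_add subspace_scale subspace_dup_vector) simp_all
  moreover have "bracket a b = scale (B v a * B c b - B v b * B c a) u
      + scale (B u b * B c a - B u a * B c b) v + scale (B u a * B v b - B u b * B v a) c"
  proof (rule form_eqI)
    fix w
    have "B (bracket a b) w = three_form a b w"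
      by (simp add: three_form_def)
    then show "B (bracket a b) w = B (scale (B v a * B c b - B v b * B c a) u
        + scale (B u b * B c a - B u a * B c b) v + scale (B u a * B v b - B u b * B v a) c) w"
      unfolding decomposed by (simp add: form_simps Bc algebra_simps)
  qed
  ultimately show ?thesis
    by simp
qed

section \<open>Central vectors\<close>

text \<open>By invariance, vectors orthogonal to \<open>[g,g]\<close> are central. If \<open>[g,g]\<close> met the centre trivially, it
  would therefore be non-degenerate, and every vector would agree with an element of \<open>[g,g]\<close> up to a
  central one. Then \<open>[[g,g],[g,g]] = [g,g]\<close>, and the derived series would be constant.\<close>

lemma solvable_center_meets_derived_algebra:
  assumes "solvable" "\<not> abelian"
  obtains c where "c \<noteq> 0" "central c" "c \<in> span {bracket x y | x y. True}"
proof (rule ccontr)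
  assume contr: "\<not> thesis"
  note witness = that
  let ?S = "span {bracket x y | x y. True}"
  have bracket_in: "bracket x y \<in> ?S" for x y
    by (rule span_base) blast
  have orth_central: "central z" if "\<And>t. t \<in> ?S \<Longrightarrow> B z t = 0" for z
  proof -
    have "B (bracket z x) y = 0" for x y
      using that[OF bracket_in] by (simp add: form_invariant)
    then show ?thesis
      unfolding central_def by (intro allI form_nondegenerate)
  qed
  have "z = 0" if "z \<in> ?S" "\<forall>t\<in>?S. B z t = 0" for z
    using contr witness[of z] orth_central[of z] that by blast
  then have nondeg: "quadratic_subspace ?S"
    by (simp add: quadratic_subspace_def)
  have reduce: "\<exists>s\<in>?S. \<forall>y. bracket x y = bracket s y" for x
  proof -
    obtain s where s: "s \<in> ?S" "\<forall>t\<in>?S. B (x - s) t = 0"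
      using orthogonal_decomposition[OF nondeg] by blast
    then have "central (x - s)"
      using orth_central by blast
    then have "\<forall>y. bracket x y = bracket s y"
      by (simp add: central_def bracket_simps)
    with s(1) show ?thesis ..
  qed
  have "bracket x y \<in> {bracket s t | s t. s \<in> ?S \<and> t \<in> ?S}" for x y
  proof -
    obtain s where s: "s \<in> ?S" "\<forall>z. bracket x z = bracket s z" using reduce[of x] by blast
    obtain t where t: "t \<in> ?S" "\<forall>z. bracket y z = bracket t z" using reduce[of y] by blast
    have "bracket x y = bracket s t"
      using s(2) t(2) bracket_anticommute[of s] by simp
    with s(1) t(1) show ?thesis by blast
  qed
  then have eq: "{bracket s t | s t. s \<in> ?S \<and> t \<in> ?S} = {bracket x y | x y. True}"
    by blast
  have "derived_series (Suc n) = ?S" for n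
  proof (induction n)
    case (Suc n)
    show ?case
      by (subst derived_series.simps) (simp only: Suc.IH eq)
  qed simp
  moreover obtain n where "derived_series n = {0}"
    using assms(1) by (auto simp: solvable_def)
  ultimately have "?S \<subseteq> {0}"
    by (cases n) auto
  with bracket_in assms(2) show False
    by (auto simp: abelian_def)
qed

text \<open>A dup vector that is not central has a commutator \<open>[t,v]\<close> independent of it, which is again a dup
  vector. Then all of \<open>[g,g]\<close> consists of dup vectors, including its central ones.\<close>

lemma ex_central_dup_vector:
  assumes "solvable" "\<not> abelian" "dup_vector v" "v \<noteq> 0"
  obtains c where "c \<noteq> 0" "central c" "dup_vector c"
proof (cases "central v")
  case True
  with assms that show ?thesis by blast
next
  case False
  then obtain t where t: "\<And>c. bracket t v \<noteq> scale c v"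
    using central_if_spans_ideal[OF assms(4)] by blast
  have "dup_vector (bracket x y)" for x y
    using brackets_are_dup_vectors[OF dup_vector_ideal[OF assms(3)] assms(3,4) t] .
  then have "span {bracket x y | x y. True} \<subseteq> {v. dup_vector v}"
    by (intro span_minimal subspace_dup_vector) auto
  moreover obtain c where "c \<noteq> 0" "central c" "c \<in> span {bracket x y | x y. True}"
    using assms(1,2) by (rule solvable_center_meets_derived_algebra)
  ultimately show ?thesis
    using that by blast
qed

text \<open>The derived series descends through the hyperplane orthogonal to \<open>v\<close> and the line spanned by
  \<open>v\<close>, and then vanishes because \<open>v\<close> is central.\<close>

lemma solvable_if_central_dup_vector:
  assumes "v \<noteq> 0" "central v" "dup_vector v"
  shows solvable
proof -
  obtain y where y: "B v y = 1"
    using assms(1) by (rule form_dual_vector)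
  have D1: "derived_series 1 \<subseteq> {x. B v x = 0}"
    using assms(2) unfolding One_nat_def derived_series.simps
    by (intro span_minimal) (auto simp: subspace_def form_simps central_def form_invariant[symmetric])
  have "bracket x z \<in> span {v}" if "B v x = 0" "B v z = 0" for x z
    using dup_vector_bracket_orthogonal[OF assms(3) y that] by (simp add: span_scale span_base)
  with D1 have D2: "derived_series (Suc 1) \<subseteq> span {v}"
    by (subst derived_series.simps) (intro span_minimal; auto)
  have "bracket x z = 0" if "x \<in> span {v}" for x z
    using that assms(2) by (auto simp: span_singleton central_def bracket_simps)
  with D2 have "derived_series (Suc (Suc 1)) \<subseteq> span {0}"
    by (subst derived_series.simps) (intro span_mono; auto)
  then have "derived_series (Suc (Suc 1)) = {0}"
    by (auto simp: span_zero)
  then show ?thesis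
    unfolding solvable_def by blast
qed

text \<open>The hyperbolic plane is spanned by \<open>v\<close> and an isotropic \<open>Y\<close> with \<open>B v Y = 1\<close>; the skew-symmetric
  map is \<open>ad Y\<close> on the orthogonal complement of the plane. It cannot vanish there, since brackets
  within the complement are determined by it.\<close>

lemma double_extension_if_central_dup_vector:
  assumes nonabelian: "\<not> abelian" and v: "v \<noteq> 0" "central v" "dup_vector v"
  obtains q C where "double_extension_by q C" "\<exists>x\<in>q. C x \<noteq> 0"
proof -
  obtain y where y: "B v y = 1"
    using v(1) by (rule form_dual_vector)
  have vv: "B v v = 0"
    using nonabelian v(3,2) by (rule central_dup_vector_isotropic)
  \<comment> \<open>As \<open>v\<close> is isotropic, adding a multiple of \<open>v\<close> to \<open>y\<close> keeps \<open>B v y = 1\<close>; this multiple makes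
    the vector isotropic.\<close>
  define Y where "Y = y - scale (B y y / 2) v"
  have Y: "B v Y = 1" "B Y v = 1" "B Y Y = 0"
    using y vv form_sym[of y v] by (simp_all add: Y_def form_simps)
  define q where "q = {x. B x v = 0 \<and> B x Y = 0}"
  have v_left: "bracket v x = 0" and v_right: "bracket x v = 0" for x
    using v(2) bracket_anticommute[of x v] by (simp_all add: central_def)
  have qI: "x - scale (B x Y) v - scale (B x v) Y \<in> q" for x
    using vv Y by (simp add: q_def form_simps)
  have sub_q: "subspace q"
    by (auto simp: subspace_def q_def form_simps)
  have in_span: "t \<in> span {v, Y} \<longleftrightarrow> (\<exists>a b. t = scale a v + scale b Y)" for t
    by (auto simp: span_insert span_singleton algebra_simps)
  have Cq: "bracket Y x \<in> q" for x
  proof -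
    have "B (bracket Y x) v = - B x (bracket Y v)" "B (bracket Y x) Y = - B x (bracket Y Y)"
      by (metis bracket_anticommute form_invariant form_minus_left)+
    then show ?thesis
      by (simp add: q_def v_right bracket_self form_simps)
  qed
  have on_q: "bracket x z = scale (B (bracket Y x) z) v" if "x \<in> q" "z \<in> q" for x z
    using that dup_vector_bracket_orthogonal[OF v(3) Y(1), of x z] form_sym[of v]
    by (simp add: q_def)
  have nondeg: "x = 0" if "x \<in> q" "\<And>z. z \<in> q \<Longrightarrow> B x z = 0" for x
  proof (rule form_nondegenerate)
    fix u
    have "B x (u - scale (B u Y) v - scale (B u v) Y) = 0"
      using that(2) qI by blast
    then show "B x u = 0"
      using that(1) by (simp add: form_simps q_def)
  qed
  have "double_extension_by q (bracket Y)"
    unfolding double_extension_by_def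
  proof (intro conjI; (rule exI[of _ v], rule exI[of _ Y], intro conjI)?)
    show "quadratic_subspace q"
      using sub_q nondeg by (auto simp: quadratic_subspace_def)
    have "B (bracket Y x) z = - B x (bracket Y z)" for x z
      by (metis bracket_anticommute form_invariant form_minus_left)
    then show "skew_symmetric_on q (bracket Y)"
      by (simp add: skew_symmetric_on_def Cq bracket_simps)
    have "t = 0" if "t \<in> q" "t \<in> span {v, Y}" for t
      using that vv Y by (auto simp: in_span q_def form_simps)
    then show "q \<inter> span {v, Y} = {0}"
      using subspace_0[OF sub_q] span_zero by blast
    show "{x + t | x t. x \<in> q \<and> t \<in> span {v, Y}} = UNIV"
    proof (intro equalityI subsetI UNIV_I CollectI)
      fix u
      have "u = (u - scale (B u Y) v - scale (B u v) Y) + (scale (B u Y) v + scale (B u v) Y)"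
        by simp
      then show "\<exists>x t. u = x + t \<and> x \<in> q \<and> t \<in> span {v, Y}"
        using qI in_span by blast
    qed
    show "\<forall>x\<in>q. \<forall>z\<in>q. \<forall>a b a' b'.
        bracket (x + scale a v + scale b Y) (z + scale a' v + scale b' Y)
          = scale b (bracket Y z) - scale b' (bracket Y x) + scale (B (bracket Y x) z) v"
      by (simp add: bracket_simps v_left v_right bracket_self on_q bracket_anticommute[of _ Y] scale_minus_right)
  qed (use vv Y in \<open>auto simp: q_def\<close>)
  moreover have "\<exists>x\<in>q. bracket Y x \<noteq> 0"
  proof (rule ccontr)
    assume "\<not> (\<exists>x\<in>q. bracket Y x \<noteq> 0)"
    then have Yq: "bracket Y x = 0" if "x \<in> q" for x
      using that by blast
    have Y0: "bracket Y u = 0" for u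
      using Yq[OF qI[of u]] by (simp add: bracket_simps v_right bracket_self)
    have "bracket u w = 0" for u w
    proof -
      have "bracket (u - scale (B u Y) v - scale (B u v) Y) (w - scale (B w Y) v - scale (B w v) Y) = 0"
        using on_q[OF qI[of u] qI[of w]] by (simp add: Y0 form_simps)
      then show ?thesis
        using bracket_anticommute[of u Y] by (simp add: bracket_simps v_left v_right Y0)
    qed
    then show False
      using nonabelian by (simp add: abelian_def)
  qed
  ultimately show ?thesis
    by (rule that)
qed

text \<open>The vector is \<open>X1\<close>. On coordinates, \<open>B X1\<close> reads off the coefficient of \<open>Y1\<close>, and
  \<open>I\<close> is the wedge product of this form with the 2-form \<open>B (C x) y\<close> on \<open>q\<close>; so \<open>B X1\<close> divides
  \<open>I\<close>.\<close>

lemma double_extension_central_dup_vector: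
  assumes "double_extension_by q C"
  obtains v where "v \<noteq> 0" "central v" "dup_vector v"
proof -
  obtain X Y where XY: "B X X = 0" "B Y Y = 0" "B X Y = 1"
    and orth: "\<And>x. x \<in> q \<Longrightarrow> B x X = 0" "\<And>x. x \<in> q \<Longrightarrow> B x Y = 0"
    and sum: "{x + t | x t. x \<in> q \<and> t \<in> span {X, Y}} = UNIV"
    and br: "\<And>x y a b a' b'. x \<in> q \<Longrightarrow> y \<in> q \<Longrightarrow>
           bracket (x + scale a X + scale b Y) (y + scale a' X + scale b' Y)
             = scale b (C y) - scale b' (C x) + scale (B (C x) y) X"
    and sub_q: "subspace q" and skew: "skew_symmetric_on q C"
    using assms unfolding double_extension_by_def quadratic_subspace_def by auto
  have Cq: "C x \<in> q" if "x \<in> q" for x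
    using skew that by (simp add: skew_symmetric_on_def)
  have zero_q: "0 \<in> q"
    using sub_q by (rule subspace_0)
  have C0: "C 0 = 0"
    using skew zero_q unfolding skew_symmetric_on_def by (metis scale_zero_left)
  have orth': "B X x = 0" "B Y x = 0" if "x \<in> q" for x
    using orth[OF that] form_sym by metis+
  have decomp: "\<exists>x a b. u = x + scale a X + scale b Y \<and> x \<in> q" for u
  proof -
    have "u \<in> {x + t | x t. x \<in> q \<and> t \<in> span {X, Y}}"
      using sum by simp
    then obtain x t where "u = x + t" "x \<in> q" "t \<in> span {X, Y}" by blast
    moreover from this(3) obtain a b where "t = scale a X + scale b Y"
      by (auto simp: span_insert span_singleton) (metis diff_add_cancel add.commute)
    ultimately show ?thesis
      by (metis add.assoc)
  qed
  have "central X"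
    unfolding central_def
  proof
    fix u
    obtain y a b where "u = y + scale a X + scale b Y" "y \<in> q"
      using decomp by blast
    then show "bracket X u = 0"
      using br[OF zero_q, of y 1 0 a b] by (simp add: C0 form_simps)
  qed
  moreover have "dup_vector X"
  proof -
    have three_form: "three_form (x + scale a X + scale b Y) (x' + scale a' X + scale b' Y)
          (x'' + scale a'' X + scale b'' Y)
        = b * B (C x') x'' - b' * B (C x) x'' + b'' * B (C x) x'"
      if "x \<in> q" "x' \<in> q" "x'' \<in> q" for x x' x'' a a' a'' b b' b''
      using that XY orth[OF Cq] orth'
      by (simp add: three_form_def br form_simps)
    have "wedge13 (B X) three_form u1 u2 u3 u4 = 0" for u1 u2 u3 u4
    proof -
      obtain x1 a1 b1 where u1: "u1 = x1 + scale a1 X + scale b1 Y" "x1 \<in> q" using decomp by blast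
      obtain x2 a2 b2 where u2: "u2 = x2 + scale a2 X + scale b2 Y" "x2 \<in> q" using decomp by blast
      obtain x3 a3 b3 where u3: "u3 = x3 + scale a3 X + scale b3 Y" "x3 \<in> q" using decomp by blast
      obtain x4 a4 b4 where u4: "u4 = x4 + scale a4 X + scale b4 Y" "x4 \<in> q" using decomp by blast
      have coord: "B X (x + scale a X + scale b Y) = b" if "x \<in> q" for x a b
        using that XY orth' by (simp add: form_simps)
      then show ?thesis
        unfolding wedge13_def u1(1) u2(1) u3(1) u4(1) using u1(2) u2(2) u3(2) u4(2)
        by (simp add: three_form coord) (simp add: algebra_simps)
    qed
    then show ?thesis
      by (simp add: dup_vector_def)
  qed
  moreover have "X \<noteq> 0"
    using XY(3) by (auto simp: form_simps)
  ultimately show ?thesis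
    using that by blast
qed

section \<open>The dup-number\<close>

text \<open>A basis of the space that defines \<open>dup\<close>, rephrased in terms of dup vectors.\<close>

lemma dup_basis:
  obtains A where "finite A" "card A = dup" "form.independent A" "\<And>f. f \<in> A \<Longrightarrow> \<exists>v. dup_vector v \<and> f = B v"
    "\<And>v. dup_vector v \<Longrightarrow> B v \<in> form.span A"
proof -
  let ?V = "{\<alpha>. Vector_Spaces.linear scale (*) \<alpha> \<and> (\<forall>x y z w. wedge13 \<alpha> three_form x y z w = 0)}"
  obtain A where A: "A \<subseteq> ?V" "form.independent A" "?V \<subseteq> form.span A" "card A = form.dim ?V"
    by (rule form.basis_exists)
  have "A \<subseteq> form.span (B ` Basis)"
    using A(1) functionals_finitely_spanned by blast
  then have "finite A"
    using form.independent_span_bound[OF finite_imageI[OF finite_Basis] A(2)] by blast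
  moreover have "\<exists>v. dup_vector v \<and> f = B v" if "f \<in> A" for f
  proof -
    have f: "f \<in> ?V"
      using that A(1) by blast
    then obtain v where "f = B v"
      by (auto elim: functional_represented)
    with f show ?thesis
      by (auto simp: dup_vector_def)
  qed
  moreover have "B v \<in> form.span A" if "dup_vector v" for v
    using that A(3) form_linear by (auto simp: dup_vector_def)
  ultimately show ?thesis
    using that A(2,4) unfolding dup_def by blast
qed

lemma dup_pos_iff: "dup \<ge> 1 \<longleftrightarrow> (\<exists>v. v \<noteq> 0 \<and> dup_vector v)"
proof -
  obtain A where A: "finite A" "card A = dup" "form.independent A"
    and rep: "\<And>f. f \<in> A \<Longrightarrow> \<exists>v. dup_vector v \<and> f = B v"
    and span: "\<And>v. dup_vector v \<Longrightarrow> B v \<in> form.span A"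
    using dup_basis by blast
  show ?thesis
  proof
    assume "dup \<ge> 1"
    then obtain f where f: "f \<in> A"
      using A(1,2) by fastforce
    then obtain v where v: "dup_vector v" "f = B v"
      using rep by blast
    have "f \<noteq> 0"
      using f A(3) form.dependent_zero by blast
    then have "v \<noteq> 0"
      using v(2) by (auto simp: form_simps fun_eq_iff)
    with v(1) show "\<exists>v. v \<noteq> 0 \<and> dup_vector v"
      by blast
  next
    assume "\<exists>v. v \<noteq> 0 \<and> dup_vector v"
    then obtain v where v: "v \<noteq> 0" "dup_vector v" by blast
    show "dup \<ge> 1"
    proof (rule ccontr)
      assume "\<not> dup \<ge> 1"
      then have "card A = 0"
        using A(2) by simp
      then have "A = {}"
        using A(1) by simp
      then have "B v = 0"
        using span[OF v(2)] by simp
      then show False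
        using v(1) form_nondegenerate[of v] by simp
    qed
  qed
qed

text \<open>If \<open>dup = 1\<close>, the ideal of dup vectors is a line.\<close>

lemma dup_one_central:
  assumes "dup = 1"
  obtains v where "v \<noteq> 0" "central v" "dup_vector v"
proof -
  obtain A where A: "finite A" "card A = dup" "form.independent A"
    and rep: "\<And>f. f \<in> A \<Longrightarrow> \<exists>v. dup_vector v \<and> f = B v"
    and span: "\<And>v. dup_vector v \<Longrightarrow> B v \<in> form.span A"
    using dup_basis by blast
  obtain f where f: "A = {f}"
    using A(2) assms by (auto simp: card_1_singleton_iff)
  then obtain v where v: "dup_vector v" "f = B v"
    using rep by blast
  have "v \<noteq> 0"
    using A(3) f v(2) form.dependent_zero[of A] by (auto simp: form_simps fun_eq_iff)
  moreover have "\<exists>c. bracket t v = scale c v" for t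
  proof -
    have "B (bracket t v) \<in> form.span {B v}"
      using span[OF dup_vector_ideal[OF v(1)]] f v(2) by simp
    then obtain c where "B (bracket t v) = form_scale c (B v)"
      by (auto simp: form.span_singleton)
    then have "bracket t v = scale c v"
      by (intro form_eqI) (simp add: form_scale_def form_simps)
    then show ?thesis ..
  qed
  ultimately show ?thesis
    using that v(1) central_if_spans_ideal by blast
qed

lemma type_S1_solvable_double_extension:
  assumes "type_S1"
  shows "solvable \<and> double_extension"
proof -
  obtain v where v: "v \<noteq> 0" "central v" "dup_vector v"
    using assms dup_one_central unfolding type_S1_def by blast
  have "double_extension"
    using assms double_extension_if_central_dup_vector[OF _ v]
    unfolding type_S1_def double_extension_def by metis
  with solvable_if_central_dup_vector[OF v] show ?thesis ..
qed

lemma singular_solvable_iff_double_extension: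
  "singular \<and> solvable \<longleftrightarrow> (\<exists>q C. double_extension_by q C \<and> (\<exists>x\<in>q. C x \<noteq> 0))"
proof
  assume "singular \<and> solvable"
  then have "\<not> abelian" "solvable" and "\<exists>v. v \<noteq> 0 \<and> dup_vector v"
    unfolding singular_def dup_pos_iff by auto
  then obtain v where "v \<noteq> 0" "central v" "dup_vector v"
    using ex_central_dup_vector by metis
  with \<open>\<not> abelian\<close> show "\<exists>q C. double_extension_by q C \<and> (\<exists>x\<in>q. C x \<noteq> 0)"
    using double_extension_if_central_dup_vector by metis
next
  assume "\<exists>q C. double_extension_by q C \<and> (\<exists>x\<in>q. C x \<noteq> 0)"
  then obtain q C x where qC: "double_extension_by q C" and x: "x \<in> q" "C x \<noteq> 0"
    by blast
  obtain v where v: "v \<noteq> 0" "central v" "dup_vector v"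
    using qC by (rule double_extension_central_dup_vector)
  have "\<not> abelian"
  proof
    assume "abelian"
    obtain X Y where br: "\<forall>x\<in>q. \<forall>y\<in>q. \<forall>a b a' b'.
           bracket (x + scale a X + scale b Y) (y + scale a' X + scale b' Y)
             = scale b (C y) - scale b' (C x) + scale (B (C x) y) X"
      using qC unfolding double_extension_by_def by blast
    have q0: "0 \<in> q" and "\<forall>c. C (scale c 0) = scale c (C 0)"
      using qC subspace_0
      unfolding double_extension_by_def quadratic_subspace_def skew_symmetric_on_def by blast+
    then have "C 0 = 0"
      by (metis scale_zero_left)
    moreover have "bracket (0 + scale 0 X + scale 1 Y) (x + scale 0 X + scale 0 Y)
        = scale 1 (C x) - scale 0 (C 0) + scale (B (C 0) x) X"
      using br q0 x(1) by blast
    ultimately have "bracket Y x = C x"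
      by (simp add: form_simps)
    with \<open>abelian\<close> x(2) show False
      by (simp add: abelian_def)
  qed
  with v show "singular \<and> solvable"
    using solvable_if_central_dup_vector unfolding singular_def dup_pos_iff by blast
qed

end

theorem theorem2:
  fixes scale :: "complex \<Rightarrow> 'a::ab_group_add \<Rightarrow> 'a"
    and Basis :: "'a set"
    and bracket :: "'a \<Rightarrow> 'a \<Rightarrow> 'a"
    and B :: "'a \<Rightarrow> 'a \<Rightarrow> complex"
  assumes "quadratic_lie_algebra scale Basis bracket B"
  shows "(quadratic_lie_algebra.type_S1 scale bracket B \<longrightarrow>
            lie_algebra.solvable scale bracket \<and>
            quadratic_lie_algebra.double_extension scale bracket B) \<and>
         (quadratic_lie_algebra.singular scale bracket B \<and> lie_algebra.solvable scale bracket
            \<longleftrightarrow> (\<exists>q C. quadratic_lie_algebra.double_extension_by scale bracket B q C \<and>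
                       (\<exists>x\<in>q. C x \<noteq> 0)))"
proof -
  interpret quadratic_lie_algebra scale Basis bracket B
    by (rule assms)
  show ?thesis
    using type_S1_solvable_double_extension singular_solvable_iff_double_extension by blast
qed

end
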